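(* Let $n\ge 1$ be an integer and let $X$ be a real-valued random variable such that $X$ and $-X$ have the same distribution and $\mathsf{E}[|X|^n]<\infty$. (i) If $n$ is odd, then $\kappa_n(X)=0$. (ii) If $n=2m$ is even, then $$|\kappa_{2m}(X)|\le C^{\mathrm{sym}}_{2m}\,\mathsf{E}[|X|^{2m}],\qquad C^{\mathrm{sym}}_{2m}:=\sum_{\pi\in\mathcal{P}_{\mathrm{even}}(2m)}(|\pi|-1)!.$$ Moreover, $$C^{\mathrm{sym}}_{2m}\sim 2\,\frac{(2m-1)!}{\rho_{\mathrm{sym}}^{\,2m}}\qquad(m\to\infty),$$ where $\rho_{\mathrm{sym}}=\operatorname{arcosh}2$.
   Context: $\mathcal{P}(n)$ is the set of all set partitions of $\{1,\dots,n\}$ into nonempty blocks, $|\pi|$ is the number of blocks of $\pi$, and $\mathcal{P}_{\mathrm{even}}(2m)=\{\pi\in\mathcal{P}(2m): |B|\text{ is even for every }B\in\pi\}$. For a random variable $X$ with $\mathsf{E}[|X|^n]<\infty$, write $m_k=\mathsf{E}[X^k]$ for $1\le k\le n$; the $n$-th cumulant is $$\kappa_n(X)=\sum_{\pi\in\mathcal{P}(n)}(-1)^{|\pi|-1}(|\pi|-1)!\prod_{B\in\pi}m_{|B|}.$$ The notation $a_m\sim b_m$ means $a_m/b_m\to1$. $\operatorname{arcosh}2=\ln(2+\sqrt3)$ is the positive real number with $\cosh(\operatorname{arcosh} 2)=2$. *)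

theory Defs
  imports "HOL-Probability.Probability" "HOL-Library.Landau_Symbols"
begin

definition set_partitions :: "nat \<Rightarrow> nat set set set" where
  "set_partitions n = {P. partition_on {1..n} P}"

definition even_set_partitions :: "nat \<Rightarrow> nat set set set" where
  "even_set_partitions n = {P \<in> set_partitions n. \<forall>B\<in>P. even (card B)}"

definition moment :: "'a measure \<Rightarrow> ('a \<Rightarrow> real) \<Rightarrow> nat \<Rightarrow> real" where
  "moment M X k = (\<integral>\<omega>. X \<omega> ^ k \<partial>M)"

(* Meaningful only when X ^ n is integrable and n is at least 1: non-integrable functions have
   Bochner integral 0, and card P - 1 is truncated subtraction on nat. *)
definition cumulant :: "'a measure \<Rightarrow> ('a \<Rightarrow> real) \<Rightarrow> nat \<Rightarrow> real" where
  "cumulant M X n =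
     (\<Sum>P\<in>set_partitions n.
        (-1) ^ (card P - 1) * fact (card P - 1) * (\<Prod>B\<in>P. moment M X (card B)))"

definition sym_cumulant_const :: "nat \<Rightarrow> real" where
  "sym_cumulant_const n = (\<Sum>P\<in>even_set_partitions n. fact (card P - 1))"

definition rho_sym :: real where
  "rho_sym = arcosh 2"

end

theory Submission
  imports Defs "HOL-Real_Asymp.Real_Asymp" "HOL-Complex_Analysis.Complex_Analysis"
begin

text \<open>
  A symmetric random variable has vanishing odd moments, so the cumulant formula only sees
  partitions into blocks of even size. For odd \<open>n\<close> there are none. For even \<open>n\<close> every
  remaining product of moments is at most \<open>E|X|^n\<close> by Lyapunov's inequality
  \<open>E|X|^b \<le> (E|X|^n)^(b/n)\<close>, because the block sizes sum to \<open>n\<close>; the triangle inequality then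
  gives the bound. Lemmas \<open>odd_moment_symmetric_eq_0\<close> and \<open>prod_expectation_abs_power_le\<close>
  carry this part.

  For the asymptotics, let \<open>E\<close> be the exponential generating function of the allowed block
  sizes. Partitions weighted by \<open>(|P| - 1)!\<close> are partitions with their blocks arranged in a
  cycle, so their generating function is \<open>- log (1 - E)\<close>, with derivative \<open>E' / (1 - E)\<close>
  (\<open>sum_fact_pred_card_restricted_partitions\<close>). For even blocks \<open>E = cosh - 1\<close>, so the
  coefficients are those of minus the logarithmic derivative of \<open>2 - cosh z\<close>. A logarithmic
  derivative has a simple pole with residue 1 at each simple zero and is otherwise holomorphic;
  hence its coefficients are those of the pole parts, up to an error governed by the radius of
  a disc containing no other zeros (\<open>logarithmic_derivative_coeffs\<close>). In the disc of radius 2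
  the zeros of \<open>2 - cosh z\<close> are the two points \<open>\<plusminus> arcosh 2\<close>, both simple. At the odd index
  \<open>2m - 1\<close> their contributions agree, which produces the factor 2.
\<close>

(* Frees the infix dollar sign for coefficients of formal power series. *)
unbundle no vec_syntax

section \<open>Moments and cumulants of symmetric random variables\<close>

text \<open>
  Concavity of \<open>u \<mapsto> u powr (b / n)\<close>, in the form of its tangent line at \<open>u = 1\<close> evaluated at
  \<open>u = t ^ n\<close>. Integrating a bound that is affine in \<open>t ^ n\<close> yields Lyapunov's inequality.
\<close>

lemma power_le_affine_power:
  fixes t :: real
  assumes "0 \<le> t" "b \<le> n" "0 < n"
  shows "t ^ b \<le> (b / n) * t ^ n + (1 - b / n)"
proof (cases "b = 0 \<or> t = 0")
  case True
  with assms show ?thesis by (auto simp: power_0_left field_simps)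
next
  case False
  then have t: "t > 0" using assms by auto
  have "(t ^ n) powr (b / n) * 1 powr (1 - b / n) \<le> (b / n) * t ^ n + (1 - b / n) * 1"
    using assms t by (intro Youngs_inequality_0) auto
  also have "(t ^ n) powr (b / n) = t ^ b"
    using assms t by (simp add: powr_powr flip: powr_realpow)
  finally show ?thesis by simp
qed

context prob_space
begin

lemma integrable_abs_power_le:
  assumes X: "X \<in> borel_measurable M" and int: "integrable M (\<lambda>\<omega>. \<bar>X \<omega>\<bar> ^ n :: real)"
    and b: "b \<le> n"
  shows "integrable M (\<lambda>\<omega>. \<bar>X \<omega>\<bar> ^ b)"
proof (rule Bochner_Integration.integrable_bound)
  show "integrable M (\<lambda>\<omega>. \<bar>X \<omega>\<bar> ^ n + 1)" using int by simp
  have "\<bar>x\<bar> ^ b \<le> \<bar>x\<bar> ^ n + 1" for x :: real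
  proof (cases "\<bar>x\<bar> \<le> 1")
    case True
    then have "\<bar>x\<bar> ^ b \<le> 1" by (intro power_le_one) auto
    then show ?thesis by (simp add: add_increasing)
  next
    case False
    then have "\<bar>x\<bar> ^ b \<le> \<bar>x\<bar> ^ n" using b by (intro power_increasing) auto
    then show ?thesis by simp
  qed
  then show "AE \<omega> in M. norm (\<bar>X \<omega>\<bar> ^ b) \<le> norm (\<bar>X \<omega>\<bar> ^ n + 1)" by simp
qed (use X in simp)

text \<open>
  Lyapunov's inequality, with \<open>c\<close> in the role of an upper bound for the \<open>L\<^sup>n\<close> norm. Keeping
  \<open>c\<close> strictly positive allows rescaling \<open>X\<close> by \<open>c\<close> even when \<open>X\<close> vanishes almost surely.
\<close>

lemma expectation_abs_power_le:
  assumes X: "X \<in> borel_measurable M" and int: "integrable M (\<lambda>\<omega>. \<bar>X \<omega>\<bar> ^ n :: real)"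
    and b: "b \<le> n" and n: "0 < n" and c: "0 < c" "expectation (\<lambda>\<omega>. \<bar>X \<omega>\<bar> ^ n) \<le> c ^ n"
  shows "expectation (\<lambda>\<omega>. \<bar>X \<omega>\<bar> ^ b) \<le> c ^ b"
proof -
  note int_b = integrable_abs_power_le[OF X int b]
  have "expectation (\<lambda>\<omega>. \<bar>X \<omega>\<bar> ^ b) / c ^ b = expectation (\<lambda>\<omega>. (\<bar>X \<omega>\<bar> / c) ^ b)"
    by (simp add: power_divide)
  also have "\<dots> \<le> expectation (\<lambda>\<omega>. (b / n) * (\<bar>X \<omega>\<bar> / c) ^ n + (1 - b / n))"
    using int int_b c b n
    by (intro integral_mono power_le_affine_power) (auto simp: power_divide)
  also have "\<dots> = (b / n) * (expectation (\<lambda>\<omega>. \<bar>X \<omega>\<bar> ^ n) / c ^ n) + (1 - b / n)"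
    using int by (simp add: power_divide prob_space)
  also have "\<dots> \<le> (b / n) * 1 + (1 - b / n)"
    using c by (intro add_right_mono mult_left_mono) auto
  finally show ?thesis using c by simp
qed

text \<open>
  Lyapunov's inequality bounds each factor by a power of one constant \<open>c\<close>, and the exponents
  add up to \<open>n\<close>. The constant is the \<open>n\<close>-th root of \<open>E|X|^n + e\<close> with \<open>e > 0\<close> arbitrary, so
  that it is positive in the degenerate case too.
\<close>

lemma prod_expectation_abs_power_le:
  assumes X: "X \<in> borel_measurable M" and int: "integrable M (\<lambda>\<omega>. \<bar>X \<omega>\<bar> ^ n :: real)"
    and n: "0 < n" and P: "finite P" "(\<Sum>B\<in>P. k B) = n"
  shows "(\<Prod>B\<in>P. expectation (\<lambda>\<omega>. \<bar>X \<omega>\<bar> ^ k B)) \<le> expectation (\<lambda>\<omega>. \<bar>X \<omega>\<bar> ^ n)"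
proof (rule field_le_epsilon)
  fix e :: real assume e: "0 < e"
  define a where "a = expectation (\<lambda>\<omega>. \<bar>X \<omega>\<bar> ^ n)"
  define c where "c = root n (a + e)"
  have a: "0 \<le> a" unfolding a_def by simp
  have c: "0 < c" "c ^ n = a + e" using a e n by (auto simp: c_def)
  have "(\<Prod>B\<in>P. expectation (\<lambda>\<omega>. \<bar>X \<omega>\<bar> ^ k B)) \<le> (\<Prod>B\<in>P. c ^ k B)"
  proof (intro prod_mono conjI)
    fix B assume "B \<in> P"
    then have "k B \<le> n" using P member_le_sum[of B P k] by auto
    then show "expectation (\<lambda>\<omega>. \<bar>X \<omega>\<bar> ^ k B) \<le> c ^ k B"
      by (rule expectation_abs_power_le[OF X int _ n]) (use c e in \<open>auto simp: a_def\<close>)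
  qed simp
  also have "\<dots> = c ^ n" by (simp add: power_sum flip: P(2))
  finally show "(\<Prod>B\<in>P. expectation (\<lambda>\<omega>. \<bar>X \<omega>\<bar> ^ k B)) \<le> expectation (\<lambda>\<omega>. \<bar>X \<omega>\<bar> ^ n) + e"
    using c by (simp add: a_def)
qed

end

lemma odd_moment_symmetric_eq_0:
  assumes X: "X \<in> borel_measurable M"
    and sym: "distr M borel X = distr M borel (\<lambda>\<omega>. - X \<omega>)" and k: "odd k"
  shows "moment M X k = 0"
proof -
  have "moment M X k = (\<integral>x. x ^ k \<partial>distr M borel X)"
    unfolding moment_def using X by (subst integral_distr) auto
  also have "\<dots> = moment M (\<lambda>\<omega>. - X \<omega>) k"
    unfolding moment_def sym using X by (subst integral_distr) auto
  also have "\<dots> = - moment M X k"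
    using k by (simp add: moment_def)
  finally show ?thesis by simp
qed

lemma set_partitions_properties:
  assumes "P \<in> set_partitions n"
  shows "finite P" "(\<Sum>B\<in>P. card B) = n"
proof -
  have P: "partition_on {1..n} P" using assms by (simp add: set_partitions_def)
  then show "finite P" using finite_elements by blast
  have "finite B" if "B \<in> P" for B
    using partition_onD1[OF P] that by (metis Sup_upper finite_atLeastAtMost finite_subset)
  then show "(\<Sum>B\<in>P. card B) = n" using product_partition[OF P] by simp
qed

text \<open>
  The reason why only partitions into even blocks contribute to the cumulants of a symmetric
  random variable.
\<close>

lemma prod_moments_symmetric_eq_0:
  assumes X: "X \<in> borel_measurable M"
    and sym: "distr M borel X = distr M borel (\<lambda>\<omega>. - X \<omega>)"
    and P: "P \<in> set_partitions n" "B \<in> P" "odd (card B)"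
  shows "(\<Prod>B\<in>P. moment M X (card B)) = 0"
  using odd_moment_symmetric_eq_0[OF X sym P(3)] set_partitions_properties(1)[OF P(1)] P(2)
  by (auto intro: prod_zero)

lemma odd_cumulant_symmetric_eq_0:
  assumes X: "X \<in> borel_measurable M"
    and sym: "distr M borel X = distr M borel (\<lambda>\<omega>. - X \<omega>)" and n: "odd n"
  shows "cumulant M X n = 0"
  unfolding cumulant_def
proof (intro sum.neutral ballI)
  fix P assume P: "P \<in> set_partitions n"
  obtain B where B: "B \<in> P" "odd (card B)"
    using n set_partitions_properties[OF P] dvd_sum[of P 2 card] by metis
  show "(- 1) ^ (card P - 1) * fact (card P - 1) * (\<Prod>B\<in>P. moment M X (card B)) = 0"
    using prod_moments_symmetric_eq_0[OF X sym P B] by simp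
qed

lemma abs_cumulant_symmetric_le:
  assumes "prob_space M" and X: "X \<in> borel_measurable M"
    and sym: "distr M borel X = distr M borel (\<lambda>\<omega>. - X \<omega>)"
    and int: "integrable M (\<lambda>\<omega>. \<bar>X \<omega>\<bar> ^ n)" and n: "0 < n"
  shows "\<bar>cumulant M X n\<bar> \<le> sym_cumulant_const n * (\<integral>\<omega>. \<bar>X \<omega>\<bar> ^ n \<partial>M)"
proof -
  interpret prob_space M by fact
  have fin: "finite (set_partitions n)"
    unfolding set_partitions_def by (intro finitely_many_partition_on) simp
  have "cumulant M X n = (\<Sum>P\<in>even_set_partitions n.
          (-1) ^ (card P - 1) * fact (card P - 1) * (\<Prod>B\<in>P. moment M X (card B)))"
    unfolding cumulant_def using fin prod_moments_symmetric_eq_0[OF X sym]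
    by (intro sum.mono_neutral_right) (auto simp: even_set_partitions_def)
  then have "\<bar>cumulant M X n\<bar> \<le> (\<Sum>P\<in>even_set_partitions n.
          \<bar>(-1) ^ (card P - 1) * fact (card P - 1) * (\<Prod>B\<in>P. moment M X (card B))\<bar>)"
    by (simp only: sum_abs)
  also have "\<dots> \<le> (\<Sum>P\<in>even_set_partitions n. fact (card P - 1) * expectation (\<lambda>\<omega>. \<bar>X \<omega>\<bar> ^ n))"
  proof (intro sum_mono)
    fix P assume "P \<in> even_set_partitions n"
    then have P: "P \<in> set_partitions n" by (simp add: even_set_partitions_def)
    have "\<bar>\<Prod>B\<in>P. moment M X (card B)\<bar> = (\<Prod>B\<in>P. \<bar>moment M X (card B)\<bar>)"
      by (rule abs_prod)
    also have "\<dots> \<le> (\<Prod>B\<in>P. expectation (\<lambda>\<omega>. \<bar>X \<omega>\<bar> ^ card B))"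
    proof (intro prod_mono conjI)
      fix B
      show "\<bar>moment M X (card B)\<bar> \<le> expectation (\<lambda>\<omega>. \<bar>X \<omega>\<bar> ^ card B)"
        using integral_abs_bound[of M "\<lambda>\<omega>. X \<omega> ^ card B"] by (simp add: moment_def power_abs)
    qed simp
    also have "\<dots> \<le> expectation (\<lambda>\<omega>. \<bar>X \<omega>\<bar> ^ n)"
      by (rule prod_expectation_abs_power_le[OF X int n set_partitions_properties[OF P]])
    finally show "\<bar>(-1) ^ (card P - 1) * fact (card P - 1) * (\<Prod>B\<in>P. moment M X (card B))\<bar>
        \<le> fact (card P - 1) * expectation (\<lambda>\<omega>. \<bar>X \<omega>\<bar> ^ n)"
      by (simp add: abs_mult power_abs)
  qed
  also have "\<dots> = sym_cumulant_const n * expectation (\<lambda>\<omega>. \<bar>X \<omega>\<bar> ^ n)"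
    by (simp add: sym_cumulant_const_def sum_distrib_right)
  finally show ?thesis .
qed

section \<open>Partitions with restricted block sizes\<close>

text \<open>
  Products of exponential generating functions count ways to split a labelled set in two: there
  are \<open>n choose j\<close> subsets of size \<open>j\<close>, and this binomial coefficient is the ratio of the
  factorials that normalise the coefficients.
\<close>

lemma sum_card_convolution:
  fixes U V :: "'a::field_char_0 fps"
  assumes "finite A"
  shows "(\<Sum>B\<in>Pow A. (fact (card B) * U $ card B) * (fact (card (A - B)) * V $ card (A - B)))
           = fact (card A) * (U * V) $ card A"
proof -
  define n where "n = card A"
  define g where "g j = (fact j * U $ j) * (fact (n - j) * V $ (n - j))" for j
  have "(\<Sum>B\<in>Pow A. (fact (card B) * U $ card B) * (fact (card (A - B)) * V $ card (A - B)))
      = (\<Sum>B\<in>Pow A. g (card B))"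
    using assms by (intro sum.cong) (auto simp: g_def n_def card_Diff_subset finite_subset)
  also have "\<dots> = (\<Sum>j\<in>{0..n}. \<Sum>B\<in>{B\<in>Pow A. card B = j}. g (card B))"
    using assms by (intro sum.group[symmetric]) (auto simp: n_def card_mono)
  also have "\<dots> = (\<Sum>j\<in>{0..n}. of_nat (n choose j) * g j)"
  proof (intro sum.cong refl)
    fix j
    have "(\<Sum>B\<in>{B\<in>Pow A. card B = j}. g (card B)) = (\<Sum>B\<in>{B. B \<subseteq> A \<and> card B = j}. g j)"
      by (intro sum.cong) auto
    then show "(\<Sum>B\<in>{B\<in>Pow A. card B = j}. g (card B)) = of_nat (n choose j) * g j"
      using n_subsets[OF assms, of j] by (simp add: n_def)
  qed
  also have "\<dots> = (\<Sum>j\<in>{0..n}. fact n * (U $ j * V $ (n - j)))"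
    by (intro sum.cong) (auto simp: g_def binomial_fact field_simps)
  finally show ?thesis
    by (simp add: n_def fps_mult_nth sum_distrib_left)
qed

definition restricted_partitions :: "(nat \<Rightarrow> bool) \<Rightarrow> 'b set \<Rightarrow> 'b set set set" where
  "restricted_partitions Q A = {P. partition_on A P \<and> (\<forall>B\<in>P. Q (card B))}"

definition block_egf :: "(nat \<Rightarrow> bool) \<Rightarrow> 'a::field_char_0 fps" where
  "block_egf Q = Abs_fps (\<lambda>j. if j > 0 \<and> Q j then 1 / fact j else 0)"

lemma finite_restricted_partitions:
  "finite A \<Longrightarrow> finite (restricted_partitions Q A)"
  unfolding restricted_partitions_def
  by (rule finite_subset[OF _ finitely_many_partition_on]) auto

text \<open>
  Removing a marked block \<open>B\<close> from a partition of \<open>A\<close> leaves a partition of \<open>A - B\<close>, and the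
  pair \<open>(B, P - {B})\<close> determines the marked partition. The predicate \<open>S\<close> says which blocks may
  be marked: any block, or only the block of a given element.
\<close>

lemma sum_marked_block:
  fixes g :: "nat \<Rightarrow> 'c::comm_monoid_add" and A :: "'b set"
  assumes A: "finite A"
  shows "(\<Sum>P\<in>restricted_partitions Q A. \<Sum>B\<in>{B\<in>P. S B}. g (card P - 1))
       = (\<Sum>B\<in>{B\<in>Pow A. B \<noteq> {} \<and> Q (card B) \<and> S B}. \<Sum>P\<in>restricted_partitions Q (A - B). g (card P))"
proof -
  have finP: "finite P" if "P \<in> restricted_partitions Q A" for P
    using that A finite_elements by (auto simp: restricted_partitions_def)
  have disj: "B \<inter> \<Union>P = {}" if "partition_on (A - B) P" for B :: "'b set" and P
    using that by (auto simp: partition_on_def)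
  have "(\<Sum>P\<in>restricted_partitions Q A. \<Sum>B\<in>{B\<in>P. S B}. g (card P - 1))
      = (\<Sum>(P, B)\<in>(SIGMA P:restricted_partitions Q A. {B\<in>P. S B}). g (card P - 1))"
    using A finP by (intro sum.Sigma) (auto intro: finite_restricted_partitions)
  also have "\<dots> = (\<Sum>(B, P)\<in>(SIGMA B:{B\<in>Pow A. B \<noteq> {} \<and> Q (card B) \<and> S B}.
                            restricted_partitions Q (A - B)). g (card P))"
  proof (rule sum.reindex_bij_witness
      [where j = "\<lambda>(P, B). (B, P - {B})" and i = "\<lambda>(B, P). (insert B P, B)"], goal_cases)
    case (1 x)
    then show ?case by auto
  next
    case (2 x)
    obtain P B where x: "x = (P, B)" by force
    with 2 have PB: "partition_on A P" "B \<in> P" "\<forall>C\<in>P. Q (card C)" "S B"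
      by (auto simp: restricted_partitions_def)
    then have "disjnt B (\<Union>(P - {B}))"
      by (auto simp: partition_on_def disjoint_def disjnt_def)
    then have "partition_on (A - B) (P - {B}) \<and> B \<subseteq> A \<and> B \<noteq> {}"
      using partition_on_insert[of B "P - {B}" A] PB by (simp add: insert_absorb)
    with PB show ?case by (auto simp: x restricted_partitions_def)
  next
    case (3 y)
    obtain P B where y: "y = (B, P)" by force
    with 3 have "partition_on (A - B) P" "B \<noteq> {}" by (auto simp: restricted_partitions_def)
    then have "B \<notin> P" using disj[of B P] by auto
    then show ?case by (simp add: y)
  next
    case (4 y)
    obtain P B where y: "y = (B, P)" by force
    with 4 have PB: "partition_on (A - B) P" "B \<subseteq> A" "B \<noteq> {}" "Q (card B)" "S B"
      "\<forall>C\<in>P. Q (card C)" by (auto simp: restricted_partitions_def)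
    then have "partition_on A (insert B P)"
      using partition_on_insert[of B P A] disj[of B P] by (auto simp: disjnt_def)
    with PB show ?case by (auto simp: y restricted_partitions_def)
  next
    case (5 x)
    then show ?case using finP by auto
  qed
  also have "\<dots> = (\<Sum>B\<in>{B\<in>Pow A. B \<noteq> {} \<and> Q (card B) \<and> S B}.
                     \<Sum>P\<in>restricted_partitions Q (A - B). g (card P))"
    using A by (intro sum.Sigma[symmetric]) (auto intro: finite_restricted_partitions)
  finally show ?thesis .
qed

text \<open>
  The weight \<open>|P|!\<close> counts linear orders of the blocks. Splitting off the first block expresses
  the generating function \<open>V\<close> through itself as \<open>V = 1 + E V\<close>, that is, \<open>V = 1 / (1 - E)\<close>.
\<close>

lemma sum_fact_card_restricted_partitions:
  assumes "finite A"
  shows "(\<Sum>P\<in>restricted_partitions Q A. fact (card P) :: 'a::field_char_0)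
           = fact (card A) * inverse (1 - block_egf Q) $ card A"
  using assms
proof (induction A rule: finite_psubset_induct)
  case (psubset A)
  define V :: "'a fps" where "V = inverse (1 - block_egf Q)"
  have V: "block_egf Q * V = V - 1"
  proof -
    have "V * (1 - block_egf Q) = 1"
      unfolding V_def by (rule inverse_mult_eq_1) (simp add: block_egf_def)
    then show ?thesis by (simp add: algebra_simps)
  qed
  show ?case
  proof (cases "A = {}")
    case True
    then show ?thesis
      by (simp add: restricted_partitions_def partition_on_empty block_egf_def
               Collect_conv_if conj_commute cong: conj_cong)
  next
    case False
    \<comment> \<open>Each of the \<open>|P|\<close> blocks of \<open>P\<close> can come first, and \<open>|P|! = |P| * (|P| - 1)!\<close>.\<close>
    have "(\<Sum>P\<in>restricted_partitions Q A. fact (card P) :: 'a)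
        = (\<Sum>P\<in>restricted_partitions Q A. \<Sum>B\<in>{B\<in>P. True}. fact (card P - 1))"
    proof (intro sum.cong refl)
      fix P assume "P \<in> restricted_partitions Q A"
      then have "card P > 0"
        using False psubset.hyps finite_elements[of A P]
        by (auto simp: restricted_partitions_def partition_on_def card_gt_0_iff)
      then show "fact (card P) = (\<Sum>B\<in>{B\<in>P. True}. fact (card P - 1) :: 'a)"
        by (simp add: fact_reduce)
    qed
    also have "\<dots> = (\<Sum>B\<in>{B\<in>Pow A. B \<noteq> {} \<and> Q (card B) \<and> True}.
                       \<Sum>P\<in>restricted_partitions Q (A - B). fact (card P))"
      by (rule sum_marked_block) fact
    also have "\<dots> = (\<Sum>B\<in>{B\<in>Pow A. B \<noteq> {} \<and> Q (card B) \<and> True}.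
                       fact (card (A - B)) * V $ card (A - B))"
      unfolding V_def by (intro sum.cong refl psubset.IH) auto
    also have "\<dots> = (\<Sum>B\<in>Pow A. (fact (card B) * block_egf Q $ card B) *
                       (fact (card (A - B)) * V $ card (A - B)))"
      using psubset.hyps
      by (intro sum.mono_neutral_cong_left)
         (auto simp: block_egf_def card_gt_0_iff intro: finite_subset)
    also have "\<dots> = fact (card A) * (block_egf Q * V) $ card A"
      by (rule sum_card_convolution) fact
    also have "\<dots> = fact (card A) * V $ card A"
      using False psubset.hyps by (simp add: V card_gt_0_iff)
    finally show ?thesis by (simp add: V_def)
  qed
qed

text \<open>
  The weight \<open>(|P| - 1)!\<close> counts cyclic arrangements of the blocks, or equivalently linear
  orders in which the block of the fixed element \<open>a\<close> comes first. Cutting out that block leaves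
  a linearly ordered partition, counted by \<open>1 / (1 - E)\<close>; the block is \<open>a\<close> together with an
  arbitrary further set, and forgetting \<open>a\<close> amounts to differentiating \<open>E\<close>.
\<close>

lemma sum_fact_pred_card_restricted_partitions:
  assumes A: "finite A" and a: "a \<notin> A"
  shows "(\<Sum>P\<in>restricted_partitions Q (insert a A). fact (card P - 1) :: 'a::field_char_0)
           = fact (card A) * (fps_deriv (block_egf Q) * inverse (1 - block_egf Q)) $ card A"
proof -
  define V :: "'a fps" where "V = inverse (1 - block_egf Q)"
  have deriv: "fact k * fps_deriv (block_egf Q) $ k = (if Q (Suc k) then 1 else 0 :: 'a)" for k
  proof -
    have "of_nat (Suc k) * fact k / fact (Suc k) = (1 :: 'a)"
      unfolding fact_Suc by (rule divide_self) (simp del: of_nat_Suc)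
    then show ?thesis by (simp add: block_egf_def mult.commute del: fact_Suc of_nat_Suc)
  qed
  have "(\<Sum>P\<in>restricted_partitions Q (insert a A). fact (card P - 1) :: 'a)
      = (\<Sum>P\<in>restricted_partitions Q (insert a A). \<Sum>B\<in>{B\<in>P. a \<in> B}. fact (card P - 1))"
  proof (intro sum.cong refl)
    fix P assume "P \<in> restricted_partitions Q (insert a A)"
    then have P: "\<Union>P = insert a A" "disjoint P"
      by (auto simp: restricted_partitions_def partition_on_def)
    then obtain B where "B \<in> P" "a \<in> B" by blast
    with P(2) have "{B\<in>P. a \<in> B} = {B}" by (auto simp: disjoint_def)
    then show "fact (card P - 1) = (\<Sum>B\<in>{B\<in>P. a \<in> B}. fact (card P - 1) :: 'a)"
      by simp
  qed
  also have "\<dots> = (\<Sum>B\<in>{B\<in>Pow (insert a A). B \<noteq> {} \<and> Q (card B) \<and> a \<in> B}.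
                     \<Sum>P\<in>restricted_partitions Q (insert a A - B). fact (card P))"
    by (rule sum_marked_block) (use A in auto)
  also have "\<dots> = (\<Sum>B\<in>{B\<in>Pow (insert a A). B \<noteq> {} \<and> Q (card B) \<and> a \<in> B}.
                     fact (card (insert a A - B)) * V $ card (insert a A - B))"
    unfolding V_def using A by (intro sum.cong refl sum_fact_card_restricted_partitions) auto
  also have "\<dots> = (\<Sum>C\<in>{C\<in>Pow A. Q (Suc (card C))}.
                     fact (card (A - C)) * V $ card (A - C))"
  proof (rule sum.reindex_bij_witness[where j = "\<lambda>B. B - {a}" and i = "insert a"], goal_cases)
    case (2 B)
    then have "finite B" using A by (auto intro: finite_subset)
    then have "Suc (card (B - {a})) = card B" using 2 by (intro card_Suc_Diff1) auto
    then show ?case using 2 by auto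
  next
    case (4 C)
    then have "card (insert a C) = Suc (card C)"
      using A a by (subst card_insert_disjoint) (auto intro: finite_subset)
    then show ?case using 4 by auto
  next
    case (5 B)
    then have "insert a A - B = A - (B - {a})" using a by auto
    then show ?case by simp
  qed (use a in auto)
  also have "\<dots> = (\<Sum>C\<in>Pow A. (fact (card C) * fps_deriv (block_egf Q) $ card C) *
                     (fact (card (A - C)) * V $ card (A - C)))"
    using A by (intro sum.mono_neutral_cong_left) (auto simp: deriv simp del: fps_deriv_nth)
  also have "\<dots> = fact (card A) * (fps_deriv (block_egf Q) * V) $ card A"
    by (rule sum_card_convolution) fact
  finally show ?thesis by (simp add: V_def)
qed

section \<open>Coefficients of logarithmic derivatives\<close>

lemma inverse_fps_X_minus_const_nth:
  fixes a :: "'a::field_char_0"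
  assumes "a \<noteq> 0"
  shows "inverse (fps_X - fps_const a) $ n = - (inverse a ^ Suc n)"
proof -
  have "fps_X - fps_const a = fps_const (- a) * (1 - fps_const (inverse a) * fps_X)"
    using assms by (simp add: fps_eq_iff fps_X_def algebra_simps)
  moreover have "inverse (1 - fps_const (inverse a) * fps_X) = Abs_fps (\<lambda>k. inverse a ^ k)"
    using one_minus_const_fps_X_neg_power'[of 1 "inverse a"] by simp
  ultimately show ?thesis
    by (simp only: fps_inverse_mult fps_const_inverse fps_mult_left_const_nth) (simp add: nonzero_inverse_minus_eq assms)
qed

lemma holomorphic_divide_simple_zero:
  fixes f :: "complex \<Rightarrow> complex"
  assumes "f holomorphic_on S" "open S" "f a = 0" "deriv f a \<noteq> 0"
  obtains h where "h holomorphic_on S" "\<And>z. f z = (z - a) * h z" "h a \<noteq> 0"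
proof
  show "(\<lambda>z. if z = a then deriv f a else (f z - f a) / (z - a)) holomorphic_on S"
    using assms by (intro pole_lemma_open)
qed (use assms in auto)

text \<open>
  The power series converges throughout the disc of holomorphy, so its terms at the point \<open>r\<close>
  tend to 0.
\<close>

lemma fps_nth_power_tendsto_0:
  fixes f :: "complex \<Rightarrow> complex"
  assumes "f has_fps_expansion F" "f holomorphic_on ball 0 R" "0 \<le> r" "r < R"
  shows "(\<lambda>n. F $ n * of_real r ^ n) \<longlonglongrightarrow> 0"
proof -
  have "ereal R \<le> fps_conv_radius F"
    using assms by (intro holomorphic_on_imp_fps_conv_radius_ge) auto
  then have "ereal (norm (of_real r :: complex)) < fps_conv_radius F"
    using assms(3,4) by (simp add: less_le_trans[where y = "ereal R"])
  then show ?thesis by (intro summable_LIMSEQ_zero summable_fps)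
qed

text \<open>
  Division by \<open>z - a\<close> for a simple zero \<open>a\<close> turns \<open>f' / f\<close> into \<open>1 / (z - a) + h' / h\<close>, where
  \<open>h\<close> has one zero fewer and the remaining zeros stay simple; the first summand has the
  coefficients \<open>- inverse a ^ Suc n\<close>. After all zeros have been split off, the logarithmic
  derivative is holomorphic on the whole disc and its coefficients are negligible.
\<close>

lemma logarithmic_derivative_coeffs:
  fixes f :: "complex \<Rightarrow> complex" and R r :: real
  assumes "finite Z" "Z \<subseteq> ball 0 R" "0 \<notin> Z" "0 \<le> r" "r < R"
    and "f holomorphic_on ball 0 R" "f has_fps_expansion F"
    and "\<And>z. z \<in> ball 0 R \<Longrightarrow> f z = 0 \<longleftrightarrow> z \<in> Z" "\<And>a. a \<in> Z \<Longrightarrow> deriv f a \<noteq> 0"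
  shows "(\<lambda>n. ((fps_deriv F * inverse F) $ n + (\<Sum>a\<in>Z. inverse a ^ Suc n)) * of_real r ^ n) \<longlonglongrightarrow> 0"
  using assms
proof (induction Z arbitrary: f F)
  case empty
  have "f 0 \<noteq> 0" using empty.prems by auto
  moreover have "F $ 0 = f 0" using fps_nth_fps_expansion[OF empty.prems(6), of 0] by simp
  ultimately have "(\<lambda>z. deriv f z * inverse (f z)) has_fps_expansion fps_deriv F * inverse F"
    using empty.prems by (intro fps_expansion_intros) auto
  moreover have "(\<lambda>z. deriv f z * inverse (f z)) holomorphic_on ball 0 R"
    using empty.prems by (intro holomorphic_intros) auto
  ultimately show ?case
    using empty.prems fps_nth_power_tendsto_0 by simp
next
  case (insert a Z)
  note hol = insert.prems(5) and zeros = insert.prems(7) and simple = insert.prems(8)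
  from insert.prems have a: "a \<noteq> 0" "a \<in> ball 0 R" by auto
  have R: "0 < R" using insert.prems by auto
  obtain h where h: "h holomorphic_on ball 0 R" "\<And>z. f z = (z - a) * h z" "h a \<noteq> 0"
    using holomorphic_divide_simple_zero[OF hol, of a] zeros[of a] simple[of a] a by auto
  define H where "H = fps_expansion h 0"
  have H: "h has_fps_expansion H"
    unfolding H_def using R by (intro has_fps_expansion_fps_expansion[OF _ _ h(1)]) auto
  have "(\<lambda>z. (z - a) * h z) has_fps_expansion (fps_X - fps_const a) * H"
    by (intro fps_expansion_intros H)
  then have F: "F = (fps_X - fps_const a) * H"
    using insert.prems(6) fps_expansion_unique_complex by (simp flip: h(2))
  have zeros_h: "h z = 0 \<longleftrightarrow> z \<in> Z" if "z \<in> ball 0 R" for z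
    using zeros[OF that] h insert.hyps by (cases "z = a") auto
  have simple_h: "deriv h b \<noteq> 0" if b: "b \<in> Z" for b
  proof -
    from b have bR: "b \<in> ball 0 R" using insert.prems by auto
    then have hb: "(h has_field_derivative deriv h b) (at b)"
      using h(1) by (intro holomorphic_derivI) auto
    have "((\<lambda>z. (z - a) * h z) has_field_derivative (b - a) * deriv h b) (at b)"
      by (rule derivative_eq_intros hb refl)+ (use zeros_h[OF bR] b in simp)
    then have "deriv f b = (b - a) * deriv h b"
      using h(2) by (metis (no_types, lifting) DERIV_imp_deriv ext)
    with simple[of b] b show ?thesis by auto
  qed
  have IH: "(\<lambda>n. ((fps_deriv H * inverse H) $ n + (\<Sum>b\<in>Z. inverse b ^ Suc n)) * of_real r ^ n) \<longlonglongrightarrow> 0"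
    by (rule insert.IH[OF _ _ _ _ h(1) H zeros_h simple_h]) (use insert.prems in auto)
  have H0: "H $ 0 \<noteq> 0"
    using fps_nth_fps_expansion[OF H, of 0] zeros_h[of 0] R insert.prems by simp
  define L where "L = fps_X - fps_const a"
  have dL: "fps_deriv L = 1" by (simp add: L_def)
  have L: "L * inverse L = 1" "H * inverse H = 1"
    using a H0 by (simp_all add: L_def inverse_mult_eq_1')
  have "fps_deriv F * inverse F = inverse L * (H * inverse H) + (L * inverse L) * (fps_deriv H * inverse H)"
    unfolding F L_def[symmetric] fps_inverse_mult fps_deriv_mult dL by (simp add: algebra_simps)
  then have "(fps_deriv F * inverse F) $ n + (\<Sum>b\<in>insert a Z. inverse b ^ Suc n)
      = (fps_deriv H * inverse H) $ n + (\<Sum>b\<in>Z. inverse b ^ Suc n)" for n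
    using insert.hyps a inverse_fps_X_minus_const_nth[of a n] by (simp add: L flip: L_def)
  with IH show ?case by simp
qed

section \<open>The even-block constants\<close>

lemma has_fps_expansion_cosh: "(cosh :: complex \<Rightarrow> complex) has_fps_expansion 1 + block_egf even"
proof (rule has_fps_expansionI, intro always_eventually allI)
  fix u :: complex
  have "(\<lambda>n. if even n then u ^ n /\<^sub>R fact n else 0) sums cosh u" by (rule cosh_converges)
  also have "(\<lambda>n. if even n then u ^ n /\<^sub>R fact n else 0)
      = (\<lambda>n. (1 + block_egf even) $ n * u ^ n)"
    by (auto simp: block_egf_def scaleR_conv_of_real field_simps fun_eq_iff)
  finally show "(\<lambda>n. (1 + block_egf even) $ n * u ^ n) sums cosh u" .
qed

text \<open>
  As a function of \<open>exp z\<close>, the equation is quadratic with roots \<open>exp w\<close> and \<open>exp (- w)\<close>, and the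
  bound on the imaginary parts excludes shifts by the period \<open>2 \<pi> \<i>\<close>.
\<close>

lemma cosh_eq_imp_eq_or_eq_minus:
  fixes z w :: complex
  assumes "cosh z = cosh w" "\<bar>Im z\<bar> + \<bar>Im w\<bar> < 2 * pi"
  shows "z = w \<or> z = - w"
proof -
  have "(exp z - exp w) * (exp z - exp (- w)) = 2 * exp z * (cosh z - cosh w)"
    by (simp add: cosh_def field_simps exp_minus power2_eq_square scaleR_conv_of_real)
  then have "exp z = exp w \<or> exp z = exp (- w)" using assms(1) by simp
  moreover have "\<bar>Im z - Im w\<bar> < 2 * pi" "\<bar>Im z - Im (- w)\<bar> < 2 * pi"
    using assms(2) by auto
  ultimately show ?thesis using exp_complex_eqI by blast
qed

text \<open>
  The upper bound places both zeros \<open>\<plusminus> rho_sym\<close> of \<open>2 - cosh z\<close> inside the disc of radius 2.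
\<close>

lemma rho_sym_bounds: "0 < rho_sym" "rho_sym < 2" and cosh_rho_sym: "cosh rho_sym = 2"
proof -
  show "0 < rho_sym" "cosh rho_sym = 2" by (auto simp: rho_sym_def)
  have "2 \<le> exp (1::real)" using exp_ge_add_one_self[of 1] by simp
  then have "2 * 2 \<le> exp (1::real) * exp 1" by (intro mult_mono) auto
  then have "4 \<le> exp (2::real)" by (simp flip: exp_add)
  then have "4 < exp (2::real) + exp (- 2)" using exp_gt_zero[of "- 2 :: real"] by linarith
  then have "2 < cosh (2::real)" by (simp add: cosh_def)
  then have "cosh rho_sym < cosh (2::real)" using \<open>cosh rho_sym = 2\<close> by simp
  then show "rho_sym < 2" using \<open>0 < rho_sym\<close> by (simp add: cosh_real_nonneg_less_iff)
qed

lemma sym_cumulant_const_Suc: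
  "complex_of_real (sym_cumulant_const (Suc n))
     = fact n * (fps_deriv (block_egf even) * inverse (1 - block_egf even)) $ n"
proof -
  have "even_set_partitions (Suc n) = restricted_partitions even (insert (Suc n) {1..n})"
    by (auto simp: even_set_partitions_def set_partitions_def restricted_partitions_def
                   atLeastAtMostSuc_conv)
  then have "complex_of_real (sym_cumulant_const (Suc n))
      = (\<Sum>P\<in>restricted_partitions even (insert (Suc n) {1..n}). fact (card P - 1))"
    by (simp add: sym_cumulant_const_def)
  also have "\<dots> = fact n * (fps_deriv (block_egf even) * inverse (1 - block_egf even)) $ n"
    using sum_fact_pred_card_restricted_partitions[of "{1..n}" "Suc n" even] by simp
  finally show ?thesis .
qed

text \<open>
  The zeros nearest to 0 other than \<open>\<plusminus> rho_sym\<close> have imaginary part \<open>\<plusminus> 2 \<pi>\<close>, so radius 2 leaves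
  exactly two poles. Splitting off their contribution, \<open>C / (2m - 1)!\<close> is
  \<open>2 / rho_sym ^ (2m)\<close> plus an error that is still negligible after multiplication by
  \<open>rho_sym ^ (2m - 1)\<close>.
\<close>

lemma sym_cumulant_const_asymp:
  "(\<lambda>m. sym_cumulant_const (2 * m))
     \<sim>[at_top] (\<lambda>m. 2 * (fact (2 * m - 1) / rho_sym ^ (2 * m)))"
proof -
  define F :: "complex fps" where "F = 1 - block_egf even"
  define \<rho> :: complex where "\<rho> = of_real rho_sym"
  have rho: "0 < rho_sym" "rho_sym < 2" "\<rho> \<noteq> 0" "norm \<rho> = rho_sym" "Im \<rho> = 0"
    using rho_sym_bounds by (auto simp: \<rho>_def)
  have cosh_rho: "cosh \<rho> = 2"
  proof -
    have "cosh \<rho> = of_real (cosh rho_sym)"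
      by (simp add: \<rho>_def cosh_def exp_of_real scaleR_conv_of_real flip: of_real_minus)
    then show ?thesis by (simp add: cosh_rho_sym)
  qed
  have "sinh \<rho> \<noteq> 0" using cosh_square_eq[of \<rho>] cosh_rho by auto
  have zeros: "2 - cosh z = 0 \<longleftrightarrow> z \<in> {\<rho>, - \<rho>}" if "z \<in> ball 0 2" for z
  proof -
    have "\<bar>Im z\<bar> < 2" using that abs_Im_le_cmod[of z] by simp
    then have "\<bar>Im z\<bar> + \<bar>Im \<rho>\<bar> < 2 * pi" using pi_gt3 rho by simp
    then show ?thesis using cosh_eq_imp_eq_or_eq_minus[of z \<rho>] cosh_rho by auto
  qed
  have "(\<lambda>n. ((fps_deriv F * inverse F) $ n + (\<Sum>a\<in>{\<rho>, - \<rho>}. inverse a ^ Suc n))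
               * of_real rho_sym ^ n) \<longlonglongrightarrow> 0"
  proof (rule logarithmic_derivative_coeffs[where f = "\<lambda>z. 2 - cosh z" and R = 2])
    show "(\<lambda>z. 2 - cosh z) holomorphic_on ball 0 2"
      unfolding cosh_def by (intro holomorphic_intros)
    have "(\<lambda>z. 2 - cosh z :: complex) has_fps_expansion 2 - (1 + block_egf even)"
      by (intro fps_expansion_intros has_fps_expansion_cosh)
    then show "(\<lambda>z. 2 - cosh z) has_fps_expansion F" by (simp add: F_def)
    show "deriv (\<lambda>z. 2 - cosh z) a \<noteq> 0" if "a \<in> {\<rho>, - \<rho>}" for a
    proof -
      have "deriv (\<lambda>z. 2 - cosh z) a = - sinh a"
        by (intro DERIV_imp_deriv) (auto intro!: derivative_eq_intros)
      then show ?thesis using that \<open>sinh \<rho> \<noteq> 0\<close> by auto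
    qed
  qed (use rho zeros in auto)
  then have "(\<lambda>n. norm (((fps_deriv F * inverse F) $ n + (\<Sum>a\<in>{\<rho>, - \<rho>}. inverse a ^ Suc n))
               * of_real rho_sym ^ n)) \<longlonglongrightarrow> 0"
    by (rule tendsto_norm_zero)
  moreover have "filterlim (\<lambda>m. 2 * m - 1 :: nat) at_top at_top" by real_asymp
  ultimately have lim: "(\<lambda>m. norm (((fps_deriv F * inverse F) $ (2 * m - 1)
       + (\<Sum>a\<in>{\<rho>, - \<rho>}. inverse a ^ Suc (2 * m - 1))) * of_real rho_sym ^ (2 * m - 1))) \<longlonglongrightarrow> 0"
    by (rule filterlim_compose)
  define q where "q m = sym_cumulant_const (2 * m) / (2 * (fact (2 * m - 1) / rho_sym ^ (2 * m)))" for m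
  \<comment> \<open>Rescaled by \<open>rho_sym / 2\<close>, the absolute error in the coefficients is the relative error of the claim.\<close>
  have "eventually (\<lambda>m. norm (((fps_deriv F * inverse F) $ (2 * m - 1)
       + (\<Sum>a\<in>{\<rho>, - \<rho>}. inverse a ^ Suc (2 * m - 1))) * of_real rho_sym ^ (2 * m - 1))
       * (rho_sym / 2) = \<bar>q m - 1\<bar>) sequentially"
    using eventually_gt_at_top[of "0::nat"]
  proof eventually_elim
    case (elim m)
    define c where "c = sym_cumulant_const (2 * m) / fact (2 * m - 1)"
    have m: "Suc (2 * m - 1) = 2 * m" using elim by simp
    have "complex_of_real c = (fps_deriv (block_egf even) * inverse F) $ (2 * m - 1)"
      using sym_cumulant_const_Suc[of "2 * m - 1", unfolded m] by (simp add: c_def F_def)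
    then have coeff: "(fps_deriv F * inverse F) $ (2 * m - 1) = - complex_of_real c"
      by (simp add: F_def)
    \<comment> \<open>The two pole contributions have equal sign because the exponent \<open>2 * m\<close> is even.\<close>
    have "\<rho> \<noteq> - \<rho>" using rho by auto
    then have poles: "(\<Sum>a\<in>{\<rho>, - \<rho>}. inverse a ^ Suc (2 * m - 1)) = of_real (2 / rho_sym ^ (2 * m))"
      unfolding m by (simp add: \<rho>_def power_inverse divide_inverse del: power_mult_distrib)
    have "norm (((fps_deriv F * inverse F) $ (2 * m - 1)
       + (\<Sum>a\<in>{\<rho>, - \<rho>}. inverse a ^ Suc (2 * m - 1))) * of_real rho_sym ^ (2 * m - 1))
       = norm (of_real ((- c + 2 / rho_sym ^ (2 * m)) * rho_sym ^ (2 * m - 1)) :: complex)"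
      unfolding coeff poles by simp
    also have "\<dots> * (rho_sym / 2) = \<bar>(- c + 2 / rho_sym ^ (2 * m)) * (rho_sym ^ Suc (2 * m - 1) / 2)\<bar>"
      using rho by (simp only: norm_of_real) (simp add: abs_mult mult_ac)
    also have "(- c + 2 / rho_sym ^ (2 * m)) * (rho_sym ^ Suc (2 * m - 1) / 2) = - (q m - 1)"
      unfolding m using rho by (simp add: q_def c_def field_simps)
    finally show ?case by simp
  qed
  moreover have "(\<lambda>m. norm (((fps_deriv F * inverse F) $ (2 * m - 1)
       + (\<Sum>a\<in>{\<rho>, - \<rho>}. inverse a ^ Suc (2 * m - 1))) * of_real rho_sym ^ (2 * m - 1))
       * (rho_sym / 2)) \<longlonglongrightarrow> 0"
    using tendsto_mult_right[OF lim, of "rho_sym / 2"] by simp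
  ultimately have "(\<lambda>m. \<bar>q m - 1\<bar>) \<longlonglongrightarrow> 0"
    by (rule Lim_transform_eventually[rotated])
  then have "(\<lambda>m. q m - 1) \<longlonglongrightarrow> 0" by (simp add: tendsto_rabs_zero_iff)
  then have "q \<longlonglongrightarrow> 1" by (simp add: LIM_zero_iff)
  then show ?thesis by (intro asymp_equivI') (simp only: q_def[abs_def])
qed

section \<open>Cumulant bound and asymptotics\<close>

theorem theorem3p8:
  fixes M :: "'a measure" and X :: "'a \<Rightarrow> real" and n :: nat
  shows "(n \<ge> 1 \<and> prob_space M \<and> X \<in> borel_measurable M
            \<and> distr M borel X = distr M borel (\<lambda>\<omega>. - X \<omega>)
            \<and> integrable M (\<lambda>\<omega>. \<bar>X \<omega>\<bar> ^ n)
          \<longrightarrow> (odd n \<longrightarrow> cumulant M X n = 0)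
            \<and> (\<forall>m. n = 2 * m \<longrightarrow>
                 \<bar>cumulant M X (2 * m)\<bar>
                   \<le> sym_cumulant_const (2 * m) * (\<integral>\<omega>. \<bar>X \<omega>\<bar> ^ (2 * m) \<partial>M)))
         \<and> (\<lambda>m. sym_cumulant_const (2 * m))
             \<sim>[at_top] (\<lambda>m. 2 * (fact (2 * m - 1) / rho_sym ^ (2 * m)))"
proof (intro conjI impI allI)
  assume *: "n \<ge> 1 \<and> prob_space M \<and> X \<in> borel_measurable M
            \<and> distr M borel X = distr M borel (\<lambda>\<omega>. - X \<omega>)
            \<and> integrable M (\<lambda>\<omega>. \<bar>X \<omega>\<bar> ^ n)"
  show "cumulant M X n = 0" if "odd n"
    using * that odd_cumulant_symmetric_eq_0 by blast
  show "\<bar>cumulant M X (2 * m)\<bar> \<le> sym_cumulant_const (2 * m) * (\<integral>\<omega>. \<bar>X \<omega>\<bar> ^ (2 * m) \<partial>M)"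
    if "n = 2 * m" for m
    using * that abs_cumulant_symmetric_le[of M X n] by simp
qed (rule sym_cumulant_const_asymp)

end
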